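(* Consider the procedure $\mathrm{PrIC3}_{\mathcal H}(\mathfrak{M},B,\lambda)$ described in the context, parameterized by subroutines $\mathrm{Strengthen}_{\mathcal H}$ and $\mathrm{Propagate}$. Suppose $\mathrm{Strengthen}_{\mathcal H}$ is sound and $\mathrm{Propagate}$ does not affect the PrIC3 invariants (both in the sense defined in the context). Then whenever $\mathrm{PrIC3}_{\mathcal H}(\mathfrak{M},B,\lambda)$ terminates and returns $\mathit{safe}=\mathtt{true}$, we have $\Pr^{\max}(s_I\models\Diamond B)\le\lambda$.
   Context: An MDP $\mathfrak{M}=(S,s_I,\mathrm{Act},P)$ has finite state set $S$, initial state $s_I$, finite action set $\mathrm{Act}$ and $P\colon S\times\mathrm{Act}\times S\to[0,1]$ with $\mathrm{Act}(s)=\{a\mid\exists s'.P(s,a,s')>0\}\ne\emptyset$ and $\sum_{s'}P(s,a,s')=1$ for $a\in\mathrm{Act}(s)$. Fix $B\subseteq S$ and $\lambda\in[0,1]$. A frame is $F\colon S\to[0,1]$, ordered pointwise; $\mathbf{0},\mathbf{1}$ are the constant frames. The Bellman operator is $\Phi(F)[s]=1$ for $s\in B$ and $\Phi(F)[s]=\max_{a\in\mathrm{Act}}\sum_{s'}P(s,a,s')F[s']$ for $s\notin B$; $\Pr^{\max}(s\models\Diamond B)=(\mathrm{lfp}\,\Phi)[s]$. Frames $F_0,\dots,F_k$ satisfy the PrIC3 invariants, $\mathrm{Inv}(F_0,\dots,F_k)$, if $F_0=\Phi(\mathbf{0})$, $F_i\le F_{i+1}$ and $\Phi(F_i)\le F_{i+1}$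 for $0\le i<k$, and $F_i[s_I]\le\lambda$ for $0\le i\le k$. Procedure $\mathrm{PrIC3}_{\mathcal H}$: set $F_0\leftarrow\Phi(\mathbf{0})$, $F_1\leftarrow\mathbf{1}$, $k\leftarrow1$, $\mathit{old}\leftarrow\emptyset$. Repeat forever: (a) $(\mathit{success},F_0,\dots,F_k,\mathit{sub})\leftarrow\mathrm{Strengthen}_{\mathcal H}(F_0,\dots,F_k)$; if $\neg\mathit{success}$ return $(\mathtt{false},\mathit{sub})$; (b) $F_{k+1}\leftarrow\mathbf{1}$; (c) $(F_0,\dots,F_{k+1})\leftarrow\mathrm{Propagate}(F_0,\dots,F_{k+1})$; (d) if $F_i=F_{i+1}$ for some $1\le i\le k$, return $\mathtt{true}$; (e) if $\mathit{old}=\mathit{sub}$ return $(\mathtt{false},\mathit{sub})$; (f) $k\leftarrow k+1$, $\mathit{old}\leftarrow\mathit{sub}$. $\mathrm{Strengthen}_{\mathcal H}$ is sound if: whenever it is called on frames $F_0,\dots,F_k$ with $\mathrm{Inv}(F_0,\dots,F_{k-1})$, $F_{k-1}\le F_k$ and $\Phi(F_{k-1})\le F_k$, terminates, and returns $\mathit{success}=\mathtt{true}$ with frames $F'_0,\dots,F'_k$, then $\mathrm{Inv}(F'_0,\dots,F'_k)$ holds. $\mathrm{Propagate}$ does not affect the PrIC3 invariants if: whenever it is called on $G_0,\dots,G_{k+1}$ with $\mathrm{Inv}(G_0,\dots,G_k)$, $G_k\le G_{k+1}$ and $\Phi(G_k)\le G_{k+1}$, the returned frames $G'_0,\dots,G'_{k+1}$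 satisfy $\mathrm{Inv}(G'_0,\dots,G'_k)$, $G'_k\le G'_{k+1}$ and $\Phi(G'_k)\le G'_{k+1}$.
   Formalization: The formal theorem additionally assumes F_0[s_I] ≤ λ, i.e. s_I ∉ B or λ = 1; otherwise Inv never holds, both subroutine conditions are vacuous, and the procedure can return true although Pr^max(s_I ⊨ ◇B) = 1 > λ. *)

theory Defs
  imports Complex_Main "HOL-Algebra.Complete_Lattice"
begin

section \<open>Markov decision processes and the Bellman operator\<close>

definition enabled :: "('s \<Rightarrow> 'a \<Rightarrow> 's \<Rightarrow> real) \<Rightarrow> 's \<Rightarrow> 'a set" where
  "enabled P s = {a. \<exists>s'. P s a s' > 0}"

locale mdp =
  fixes P :: "'s::finite \<Rightarrow> 'a::finite \<Rightarrow> 's \<Rightarrow> real"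
  assumes P_range: "P s a s' \<in> {0..1}"
    and enabled_nonempty: "enabled P s \<noteq> {}"
    and P_sum: "a \<in> enabled P s \<Longrightarrow> (\<Sum>s'\<in>UNIV. P s a s') = 1"

type_synonym 's frame = "'s \<Rightarrow> real"

definition frames :: "'s frame set" where
  "frames = {F. \<forall>s. F s \<in> {0..1}}"

definition bellman ::
  "('s::finite \<Rightarrow> 'a::finite \<Rightarrow> 's \<Rightarrow> real) \<Rightarrow> 's set \<Rightarrow> 's frame \<Rightarrow> 's frame" where
  "bellman P B F s =
     (if s \<in> B then 1 else Max (range (\<lambda>a. \<Sum>s'\<in>UNIV. P s a s' * F s')))"

definition frame_lattice :: "'s frame gorder" where
  "frame_lattice = \<lparr>carrier = frames, eq = (=), le = (\<le>)\<rparr>"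

text \<open>
  The least fixed point is taken in the lattice of \<open>[0,1]\<close>-valued frames; the lemmas
  \<open>Pr_max_fixed_point\<close> and \<open>Pr_max_least\<close> below confirm that it exists.
\<close>

definition Pr_max ::
  "('s::finite \<Rightarrow> 'a::finite \<Rightarrow> 's \<Rightarrow> real) \<Rightarrow> 's set \<Rightarrow> 's \<Rightarrow> real" where
  "Pr_max P B s = (LFP\<^bsub>frame_lattice\<^esub> (bellman P B)) s"

lemma frame_lattice_sel [simp]:
  "carrier frame_lattice = frames"
  "eq frame_lattice = (=)"
  "F \<sqsubseteq>\<^bsub>frame_lattice\<^esub> G \<longleftrightarrow> F \<le> G"
  by (simp_all add: frame_lattice_def)

lemma complete_lattice_frame_lattice: "complete_lattice (frame_lattice :: 's frame gorder)"
proof -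
  interpret partial_order "frame_lattice :: 's frame gorder"
    by unfold_locales auto
  show ?thesis
  proof (rule complete_latticeI)
    fix A :: "'s frame set"
    assume "A \<subseteq> carrier frame_lattice"
    then have A: "\<And>F s. F \<in> A \<Longrightarrow> 0 \<le> F s \<and> F s \<le> 1"
      by (auto simp: frames_def)
    have bdd: "bdd_above ((\<lambda>F. F s) ` A)" "bdd_below ((\<lambda>F. F s) ` A)" for s
      using A by (auto intro!: bdd_aboveI2 bdd_belowI2)
    define U :: "'s frame" where "U = (\<lambda>s. if A = {} then 0 else SUP F\<in>A. F s)"
    define L :: "'s frame" where "L = (\<lambda>s. if A = {} then 1 else INF F\<in>A. F s)"
    have U_upper: "F s \<le> U s" and L_lower: "L s \<le> F s" if "F \<in> A" for F s
      using that bdd by (auto simp: U_def L_def intro!: cSUP_upper cINF_lower)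
    have U_least: "U s \<le> c" if "\<And>F. F \<in> A \<Longrightarrow> F s \<le> c" "0 \<le> c" for s c
      using that by (auto simp: U_def intro!: cSUP_least)
    have L_greatest: "c \<le> L s" if "\<And>F. F \<in> A \<Longrightarrow> c \<le> F s" "c \<le> 1" for s c
      using that by (auto simp: L_def intro!: cINF_greatest)
    have "U \<in> frames"
      unfolding frames_def atLeastAtMost_iff mem_Collect_eq
    proof (intro allI conjI)
      show "0 \<le> U s" for s
      proof (cases "A = {}")
        case False
        then obtain F where "F \<in> A" by blast
        then show ?thesis using A U_upper order_trans by blast
      qed (simp add: U_def)
      show "U s \<le> 1" for s using A U_least by auto
    qed
    moreover have "L \<in> frames"
      unfolding frames_def atLeastAtMost_iff mem_Collect_eq
    proof (intro allI conjI)
      show "L s \<le> 1" for s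
      proof (cases "A = {}")
        case False
        then obtain F where "F \<in> A" by blast
        then show ?thesis using A L_lower order_trans by blast
      qed (simp add: L_def)
      show "0 \<le> L s" for s using A L_greatest by auto
    qed
    ultimately have "least frame_lattice U (Upper frame_lattice A)"
      and "greatest frame_lattice L (Lower frame_lattice A)"
      using A U_upper U_least L_lower L_greatest
      by (auto simp: least_def greatest_def Upper_def Lower_def frames_def le_fun_def)
    then show "\<exists>s. least frame_lattice s (Upper frame_lattice A)"
      and "\<exists>i. greatest frame_lattice i (Lower frame_lattice A)"
      by blast+
  qed
qed

context mdp
begin

lemma bellman_in_frames: "F \<in> frames \<Longrightarrow> bellman P B F \<in> frames"
proof -
  assume F: "F \<in> frames"
  have "(\<Sum>s'\<in>UNIV. P s a s' * F s') \<in> {0..1}" for s a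
  proof (cases "a \<in> enabled P s")
    case True
    have "(\<Sum>s'\<in>UNIV. P s a s' * F s') \<le> (\<Sum>s'\<in>UNIV. P s a s')"
      using F P_range by (intro sum_mono mult_left_le) (auto simp: frames_def)
    moreover have "0 \<le> (\<Sum>s'\<in>UNIV. P s a s' * F s')"
      using F P_range by (intro sum_nonneg mult_nonneg_nonneg) (auto simp: frames_def)
    ultimately show ?thesis using P_sum[OF True] by simp
  next
    case False
    then have "P s a s' = 0" for s'
      using P_range[of s a s'] unfolding enabled_def atLeastAtMost_iff mem_Collect_eq
      by (meson le_less not_less)
    then show ?thesis by simp
  qed
  then have r: "range (\<lambda>a. \<Sum>s'\<in>UNIV. P s a s' * F s') \<subseteq> {0..1}" for s
    by blast
  have "Max (range (\<lambda>a. \<Sum>s'\<in>UNIV. P s a s' * F s')) \<in> {0..1}" for s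
    by (rule subsetD[OF r[of s]], rule Max_in) auto
  then show ?thesis by (auto simp: frames_def bellman_def)
qed

lemma bellman_mono: "F \<le> G \<Longrightarrow> bellman P B F \<le> bellman P B G"
proof (rule le_funI)
  fix s
  assume "F \<le> G"
  then have "(\<Sum>s'\<in>UNIV. P s a s' * F s') \<le> (\<Sum>s'\<in>UNIV. P s a s' * G s')" for a
    using P_range by (intro sum_mono mult_left_mono) (auto simp: le_fun_def)
  also have "(\<Sum>s'\<in>UNIV. P s a s' * G s')
      \<le> Max (range (\<lambda>a. \<Sum>s'\<in>UNIV. P s a s' * G s'))" for a
    by (rule Max_ge) auto
  finally show "bellman P B F s \<le> bellman P B G s"
    by (auto simp: bellman_def)
qed

lemma Pr_max_fixed_point:
  "Pr_max P B \<in> frames" "bellman P B (Pr_max P B) = Pr_max P B"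
proof -
  interpret complete_lattice "frame_lattice :: 's frame gorder"
    by (rule complete_lattice_frame_lattice)
  have iso: "isotone frame_lattice frame_lattice (bellman P B)"
    using bellman_mono
    by (auto intro!: isotoneI weak_partial_order_axioms)
  have eq: "Pr_max P B = LFP\<^bsub>frame_lattice\<^esub> (bellman P B)"
    by (rule ext) (simp add: Pr_max_def)
  show "Pr_max P B \<in> frames"
    using LFP_closed by (simp add: eq)
  show "bellman P B (Pr_max P B) = Pr_max P B"
    using LFP_unfold[OF iso] bellman_in_frames by (simp add: eq)
qed

end

lemma Pr_max_least:
  assumes "F \<in> frames" "bellman P B F \<le> F"
  shows "Pr_max P B \<le> F"
proof -
  interpret complete_lattice "frame_lattice :: 's frame gorder"
    by (rule complete_lattice_frame_lattice)
  show ?thesis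
    using LFP_lowerbound[of F "bellman P B"] assms by (simp add: Pr_max_def le_fun_def)
qed


section \<open>The PrIC3 invariants\<close>

text \<open>A sequence \<open>F\<^sub>0, \<dots>, F\<^sub>k\<close> is a list of length \<open>k + 1\<close>.\<close>

definition pric3_inv ::
  "('s::finite \<Rightarrow> 'a::finite \<Rightarrow> 's \<Rightarrow> real) \<Rightarrow> 's \<Rightarrow> 's set \<Rightarrow> real \<Rightarrow> 's frame list \<Rightarrow> bool" where
  "pric3_inv P s\<^sub>I B lam Fs \<longleftrightarrow>
     Fs \<noteq> [] \<and>
     Fs ! 0 = bellman P B (\<lambda>_. 0) \<and>
     (\<forall>i. Suc i < length Fs \<longrightarrow>
        Fs ! i \<le> Fs ! Suc i \<and> bellman P B (Fs ! i) \<le> Fs ! Suc i) \<and>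
     (\<forall>i < length Fs. (Fs ! i) s\<^sub>I \<le> lam)"

text \<open>
  For \<open>F\<^sub>0, \<dots>, F\<^sub>k\<close>: the invariants hold for \<open>F\<^sub>0, \<dots>, F\<^bsub>k-1\<^esub>\<close>, and the last frame is only
  required to satisfy \<open>F\<^bsub>k-1\<^esub> \<le> F\<^sub>k\<close> and \<open>\<Phi> F\<^bsub>k-1\<^esub> \<le> F\<^sub>k\<close>. In particular \<open>k \<ge> 1\<close>.
\<close>

definition pric3_inv_butlast ::
  "('s::finite \<Rightarrow> 'a::finite \<Rightarrow> 's \<Rightarrow> real) \<Rightarrow> 's \<Rightarrow> 's set \<Rightarrow> real \<Rightarrow> 's frame list \<Rightarrow> bool" where
  "pric3_inv_butlast P s\<^sub>I B lam Fs \<longleftrightarrow>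
     pric3_inv P s\<^sub>I B lam (butlast Fs) \<and>
     last (butlast Fs) \<le> last Fs \<and>
     bellman P B (last (butlast Fs)) \<le> last Fs"


section \<open>Subroutines\<close>

text \<open>
  Subroutines are input/output relations: \<open>strengthen Fs (success, Fs', sub)\<close> means that the
  call on \<open>Fs\<close> may terminate with that result. Divergence is the absence of a result.
\<close>

type_synonym ('s, 'c) strengthen_proc = "'s frame list \<Rightarrow> bool \<times> 's frame list \<times> 'c set \<Rightarrow> bool"
type_synonym 's propagate_proc = "'s frame list \<Rightarrow> 's frame list \<Rightarrow> bool"

text \<open>
  The signatures: a call on \<open>k + 1\<close> frames can only return \<open>k + 1\<close> frames.
\<close>

definition strengthen_typed :: "('s, 'c) strengthen_proc \<Rightarrow> bool" where
  "strengthen_typed strengthen \<longleftrightarrow>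
     (\<forall>Fs success Fs' sub. Fs \<in> lists frames \<and> strengthen Fs (success, Fs', sub) \<longrightarrow>
        Fs' \<in> lists frames \<and> length Fs' = length Fs)"

definition propagate_typed :: "'s propagate_proc \<Rightarrow> bool" where
  "propagate_typed propagate \<longleftrightarrow>
     (\<forall>Gs Gs'. Gs \<in> lists frames \<and> propagate Gs Gs' \<longrightarrow>
        Gs' \<in> lists frames \<and> length Gs' = length Gs)"

definition strengthen_sound ::
  "('s::finite \<Rightarrow> 'a::finite \<Rightarrow> 's \<Rightarrow> real) \<Rightarrow> 's \<Rightarrow> 's set \<Rightarrow> real \<Rightarrow>
   ('s, 'c) strengthen_proc \<Rightarrow> bool" where
  "strengthen_sound P s\<^sub>I B lam strengthen \<longleftrightarrow>
     (\<forall>Fs Fs' sub.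
        Fs \<in> lists frames \<and> pric3_inv_butlast P s\<^sub>I B lam Fs \<and>
        strengthen Fs (True, Fs', sub) \<longrightarrow>
        pric3_inv P s\<^sub>I B lam Fs')"

definition propagate_preserves_inv ::
  "('s::finite \<Rightarrow> 'a::finite \<Rightarrow> 's \<Rightarrow> real) \<Rightarrow> 's \<Rightarrow> 's set \<Rightarrow> real \<Rightarrow>
   's propagate_proc \<Rightarrow> bool" where
  "propagate_preserves_inv P s\<^sub>I B lam propagate \<longleftrightarrow>
     (\<forall>Gs Gs'.
        Gs \<in> lists frames \<and> pric3_inv_butlast P s\<^sub>I B lam Gs \<and> propagate Gs Gs' \<longrightarrow>
        pric3_inv_butlast P s\<^sub>I B lam Gs')"


section \<open>The procedure PrIC3\<close>

datatype 'c verdict = Return_True | Return_False "'c set"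

text \<open>
  Big-step semantics of the loop: \<open>pric3_loop strengthen propagate Fs old v\<close> means that the loop,
  entered with frames \<open>F\<^sub>0, \<dots>, F\<^sub>k\<close>, where \<open>k = length Fs - 1\<close>, may terminate with verdict \<open>v\<close>.
  Appending a frame increments \<open>k\<close>.
\<close>

definition has_equal_frames :: "'s frame list \<Rightarrow> bool" where
  "has_equal_frames Gs \<longleftrightarrow> (\<exists>i\<ge>1. Suc i < length Gs \<and> Gs ! i = Gs ! Suc i)"

inductive pric3_loop ::
  "('s, 'c) strengthen_proc \<Rightarrow> 's propagate_proc \<Rightarrow>
   's frame list \<Rightarrow> 'c set \<Rightarrow> 'c verdict \<Rightarrow> bool"
  for strengthen :: "('s, 'c) strengthen_proc" and propagate :: "'s propagate_proc" where
  strengthen_fails: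
    "strengthen Fs (False, Fs', sub) \<Longrightarrow>
     pric3_loop strengthen propagate Fs old (Return_False sub)"
| inductive_frame:
    "strengthen Fs (True, Fs', sub) \<Longrightarrow> propagate (Fs' @ [\<lambda>_. 1]) Gs \<Longrightarrow>
     has_equal_frames Gs \<Longrightarrow>
     pric3_loop strengthen propagate Fs old Return_True"
| same_subsystem:
    "strengthen Fs (True, Fs', sub) \<Longrightarrow> propagate (Fs' @ [\<lambda>_. 1]) Gs \<Longrightarrow>
     \<not> has_equal_frames Gs \<Longrightarrow> old = sub \<Longrightarrow>
     pric3_loop strengthen propagate Fs old (Return_False sub)"
| iterate:
    "strengthen Fs (True, Fs', sub) \<Longrightarrow> propagate (Fs' @ [\<lambda>_. 1]) Gs \<Longrightarrow>
     \<not> has_equal_frames Gs \<Longrightarrow> old \<noteq> sub \<Longrightarrow>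
     pric3_loop strengthen propagate Gs sub v \<Longrightarrow>
     pric3_loop strengthen propagate Fs old v"

definition pric3_returns ::
  "('s::finite \<Rightarrow> 'a::finite \<Rightarrow> 's \<Rightarrow> real) \<Rightarrow> 's set \<Rightarrow>
   ('s, 'c) strengthen_proc \<Rightarrow> 's propagate_proc \<Rightarrow> 'c verdict \<Rightarrow> bool" where
  "pric3_returns P B strengthen propagate v \<longleftrightarrow>
     pric3_loop strengthen propagate [bellman P B (\<lambda>_. 0), \<lambda>_. 1] {} v"

end

(* A pair of equal frames F_i = F_{i+1} turns the invariant \<Phi>(F_i) \<le> F_{i+1} into \<Phi>(F_i) \<le> F_i, so F_i
   is a pre-fixed point of the Bellman operator and dominates Pr^max by Knaster-Tarski; moreover
   F_i[s_I] \<le> lam. This index i is at most k, so all this needs only the invariant that holds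
   throughout the loop: full invariants on all frames but the last. *)

theory Submission
  imports Defs
begin

lemma frames_snoc_one: "Fs \<in> lists frames \<Longrightarrow> Fs @ [\<lambda>_. 1] \<in> lists frames"
  by (auto simp: frames_def)

text \<open>Frames before the last inherit the bound, and the inequalities among them, from
  \<open>butlast Gs\<close>; the inequality into the last frame is the extra conjunct of
  \<open>pric3_inv_butlast\<close>.\<close>

lemma pric3_inv_butlast_nth:
  assumes "pric3_inv_butlast P s\<^sub>I B lam Gs" "Suc i < length Gs"
  shows "bellman P B (Gs ! i) \<le> Gs ! Suc i" "(Gs ! i) s\<^sub>I \<le> lam"
proof -
  have inv: "pric3_inv P s\<^sub>I B lam (butlast Gs)"
    and last: "bellman P B (last (butlast Gs)) \<le> last Gs"
    using assms(1) by (simp_all add: pric3_inv_butlast_def)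
  have nth: "butlast Gs ! i = Gs ! i"
    using assms(2) by (simp add: nth_butlast)
  have "i < length (butlast Gs)"
    using assms(2) by simp
  with nth show "(Gs ! i) s\<^sub>I \<le> lam"
    using inv by (metis pric3_inv_def)
  show "bellman P B (Gs ! i) \<le> Gs ! Suc i"
  proof (cases "Suc (Suc i) < length Gs")
    case True
    then show ?thesis
      using inv nth by (auto simp: pric3_inv_def nth_butlast)
  next
    case False
    then have len: "length Gs = Suc (Suc i)" using assms(2) by simp
    then have "length (butlast Gs) = Suc i" by simp
    then have "last (butlast Gs) = Gs ! i"
      using nth by (metis diff_Suc_1 last_conv_nth length_0_conv nat.distinct(1))
    moreover have "last Gs = Gs ! Suc i"
      using len by (metis diff_Suc_1 last_conv_nth length_0_conv nat.distinct(1))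
    ultimately show ?thesis using last by simp
  qed
qed

text \<open>Since frames take values in [0,1], the constant 1 dominates both \<open>last Fs\<close>
  and its Bellman image; the appended frame itself need not obey the bound
  \<open>lam\<close>.\<close>

lemma (in mdp) pric3_inv_butlast_snoc_one:
  assumes "Fs \<in> lists frames" "pric3_inv P s\<^sub>I B lam Fs"
  shows "pric3_inv_butlast P s\<^sub>I B lam (Fs @ [\<lambda>_. 1])"
proof -
  have "last Fs \<in> frames"
    using assms by (auto simp: pric3_inv_def)
  with bellman_in_frames[of "last Fs" B] show ?thesis
    using assms(2) by (auto simp: pric3_inv_butlast_def frames_def le_fun_def)
qed

lemma Pr_max_le_of_equal_frames:
  assumes "Gs \<in> lists frames" "pric3_inv_butlast P s\<^sub>I B lam Gs" "has_equal_frames Gs"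
  shows "Pr_max P B s\<^sub>I \<le> lam"
proof -
  from assms(3) obtain i where i: "Suc i < length Gs" "Gs ! i = Gs ! Suc i"
    by (auto simp: has_equal_frames_def)
  have "Gs ! i \<in> frames"
    using assms(1) i(1) by (auto simp: in_lists_conv_set)
  then have "Pr_max P B \<le> Gs ! i"
    using pric3_inv_butlast_nth(1)[OF assms(2) i(1)] i(2) by (auto intro: Pr_max_least)
  then show ?thesis
    using pric3_inv_butlast_nth(2)[OF assms(2) i(1)] by (auto simp: le_fun_def intro: order_trans)
qed

text \<open>One pass of the loop: \<open>strengthen\<close> upgrades the \<open>butlast\<close> form
  to the full invariants, appending 1 gives the \<open>butlast\<close> form of the longer list, and
  \<open>propagate\<close> keeps it.\<close>

lemma (in mdp) pric3_iteration_preserves_inv: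
  assumes "strengthen_typed strengthen" "propagate_typed propagate"
    and "strengthen_sound P s\<^sub>I B lam strengthen"
    and "propagate_preserves_inv P s\<^sub>I B lam propagate"
    and Fs: "Fs \<in> lists frames" "pric3_inv_butlast P s\<^sub>I B lam Fs"
    and step: "strengthen Fs (True, Fs', sub)" "propagate (Fs' @ [\<lambda>_. 1]) Gs"
  shows "Gs \<in> lists frames" "pric3_inv_butlast P s\<^sub>I B lam Gs"
proof -
  have Fs': "Fs' \<in> lists frames"
    using assms(1) Fs(1) step(1) unfolding strengthen_typed_def by blast
  have inv: "pric3_inv P s\<^sub>I B lam Fs'"
    using assms(3) Fs step(1) unfolding strengthen_sound_def by blast
  show "Gs \<in> lists frames"
    using assms(2) frames_snoc_one[OF Fs'] step(2) unfolding propagate_typed_def by blast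
  show "pric3_inv_butlast P s\<^sub>I B lam Gs"
    using assms(4) frames_snoc_one[OF Fs'] pric3_inv_butlast_snoc_one[OF Fs' inv] step(2)
    unfolding propagate_preserves_inv_def by blast
qed

lemma (in mdp) pric3_loop_sound:
  fixes strengthen :: "('s, 'c) strengthen_proc"
  assumes "pric3_loop strengthen propagate Fs old Return_True"
    and "strengthen_typed strengthen" "propagate_typed propagate"
    and "strengthen_sound P s\<^sub>I B lam strengthen"
    and "propagate_preserves_inv P s\<^sub>I B lam propagate"
    and "Fs \<in> lists frames" "pric3_inv_butlast P s\<^sub>I B lam Fs"
  shows "Pr_max P B s\<^sub>I \<le> lam"
  using assms(1,6,7)
\<comment> \<open>Fixing the verdict rules out the two rules that yield
  \<open>Return_False\<close>.\<close>
proof (induction Fs old "Return_True :: 'c verdict" rule: pric3_loop.induct)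
  case (inductive_frame Fs Fs' sub Gs old)
  then show ?case
    using pric3_iteration_preserves_inv[OF assms(2-5)] Pr_max_le_of_equal_frames by metis
next
  case (iterate Fs Fs' sub Gs old)
  then show ?case
    using pric3_iteration_preserves_inv[OF assms(2-5)] by metis
qed

theorem theorem1:
  fixes P :: "'s::finite \<Rightarrow> 'a::finite \<Rightarrow> 's \<Rightarrow> real"
    and s\<^sub>I :: 's and B :: "'s set" and lam :: real
    and strengthen :: "('s, 'c) strengthen_proc"
    and propagate :: "'s propagate_proc"
  assumes "mdp P"
    and "lam \<in> {0..1}"
    and "strengthen_typed strengthen"
    and "propagate_typed propagate"
    \<comment> \<open>\<open>Inv(F\<^sub>0)\<close> holds when the loop is first entered, i.e. \<open>s\<^sub>I \<notin> B\<close> or \<open>lam = 1\<close>; otherwise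
       soundness of \<open>strengthen\<close> does not constrain the first call and the claim is false\<close>
    and "bellman P B (\<lambda>_. 0) s\<^sub>I \<le> lam"
    and "strengthen_sound P s\<^sub>I B lam strengthen"
    and "propagate_preserves_inv P s\<^sub>I B lam propagate"
    and "pric3_returns P B strengthen propagate Return_True"
  shows "Pr_max P B s\<^sub>I \<le> lam"
proof -
  interpret mdp P by (rule assms(1))
  let ?F\<^sub>0 = "bellman P B (\<lambda>_. 0)"
  have "?F\<^sub>0 \<in> frames"
    by (rule bellman_in_frames) (simp add: frames_def)
  then have "[?F\<^sub>0] \<in> lists frames" by simp
  \<comment> \<open>A single frame has no successor pair, so only the bound at
    \<open>s\<^sub>I\<close> remains; appending 1 then gives the list on which the loop
    starts.\<close>
  moreover have "pric3_inv P s\<^sub>I B lam [?F\<^sub>0]"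
    using assms(5) by (simp add: pric3_inv_def)
  ultimately have "[?F\<^sub>0, \<lambda>_. 1] \<in> lists frames"
    and "pric3_inv_butlast P s\<^sub>I B lam [?F\<^sub>0, \<lambda>_. 1]"
    using frames_snoc_one[of "[?F\<^sub>0]"] pric3_inv_butlast_snoc_one[of "[?F\<^sub>0]"] by simp_all
  then show ?thesis
    using pric3_loop_sound[OF _ assms(3,4,6,7)] assms(8) unfolding pric3_returns_def by blast
qed

end
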